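(* Let $n\ge 3$ and let $\alpha<\sqrt{2}$ be a real number. Then there are a constant $H<\infty$, an invertible affine mapping $A:\mathbb{R}^n\to\mathbb{R}^n$, and a sequence of quasiconformal mappings $f_j:\mathbb{R}^n\to\mathbb{R}^n$, $j=1,2,\ldots$, such that $H(x,f_j)\le H$ for every $j$ and almost every $x\in\mathbb{R}^n$ (that is, $H(f_j)\le H$), such that $f_j\to A$ locally uniformly on $\mathbb{R}^n$, and such that $$H(A)\ \ge\ \alpha\, H,$$ where $H(A)=H(x,A)$ for every $x\in\mathbb{R}^n$.
   Context: Let $\Omega$ be a domain in $\mathbb{R}^n$ and $f:\Omega\to f(\Omega)\subset\mathbb{R}^n$ a homeomorphism. For $x\in\Omega$ the linear distortion at $x$ is $$H(x,f)=\limsup_{r\to 0}\frac{\max_{|x-y|=r}|f(x)-f(y)|}{\min_{|x-y|=r}|f(x)-f(y)|}.$$ If $H(x,f)$ is bounded in $\Omega$, then $f$ is called quasiconformal, and its linear distortion is $H(f)=\|H(x,f)\|_{L^\infty(\Omega)}$ (essential supremum); $f$ is then called $H$-quasiconformal with $H=H(f)$. For an invertible affine map $A$, $H(x,A)$ is independent of $x$ and equals the ratio of the largest to the smallest singular value of the differential of $A$. *)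

theory Defs
  imports "HOL-Analysis.Analysis" "HOL-Probability.Essential_Supremum"
begin

text \<open>For a homeomorphism \<open>f\<close> of an open set containing \<open>x\<close>, the sphere of small radius \<open>r > 0\<close>
  is a compact subset of the domain. There the supremum and infimum are attained, the infimum is
  positive, and the quotient is a genuine quotient of reals. The value of the upper limit may
  be \<open>\<infinity>\<close>.\<close>

definition linear_distortion_at :: "(real ^ 'n \<Rightarrow> real ^ 'n) \<Rightarrow> real ^ 'n \<Rightarrow> ereal" where
  "linear_distortion_at f x =
     Limsup (at_right (0::real))
       (\<lambda>r. ereal ((SUP y\<in>sphere x r. dist (f x) (f y)) / (INF y\<in>sphere x r. dist (f x) (f y))))"

definition quasiconformal_on :: "(real ^ 'n) set \<Rightarrow> (real ^ 'n \<Rightarrow> real ^ 'n) \<Rightarrow> bool" where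
  "quasiconformal_on \<Omega> f \<longleftrightarrow>
     open \<Omega> \<and> connected \<Omega> \<and> \<Omega> \<noteq> {} \<and>
     (\<exists>g. homeomorphism \<Omega> (f ` \<Omega>) f g) \<and>
     (\<exists>M::real. \<forall>x\<in>\<Omega>. linear_distortion_at f x \<le> ereal M)"

definition linear_distortion :: "(real ^ 'n) set \<Rightarrow> (real ^ 'n \<Rightarrow> real ^ 'n) \<Rightarrow> ereal" where
  "linear_distortion \<Omega> f = esssup (lebesgue_on \<Omega>) (linear_distortion_at f)"

definition invertible_affine :: "(real ^ 'n \<Rightarrow> real ^ 'n) \<Rightarrow> bool" where
  "invertible_affine A \<longleftrightarrow>
     (\<exists>(L :: real ^ 'n ^ 'n) b. invertible L \<and> A = (\<lambda>x. L *v x + b))"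

text \<open>Since \<open>\<real>\<^sup>n\<close> is locally compact, locally uniform convergence is uniform convergence on
  compact sets.\<close>

definition locally_uniform_limit ::
  "(nat \<Rightarrow> real ^ 'n \<Rightarrow> real ^ 'n) \<Rightarrow> (real ^ 'n \<Rightarrow> real ^ 'n) \<Rightarrow> bool" where
  "locally_uniform_limit f A \<longleftrightarrow> (\<forall>K. compact K \<longrightarrow> uniform_limit K f A sequentially)"

end

theory Submission imports Defs begin

text \<open>A single laminate suffices. Fix three coordinates \<open>i\<close>, \<open>j\<close>, \<open>k\<close> and consider the maps
  \<open>x\<^sub>i \<mapsto> x\<^sub>i / 10\<close>, \<open>x\<^sub>j \<mapsto> x\<^sub>j + 3 p(x\<^sub>i)\<close>, \<open>x\<^sub>k \<mapsto> x\<^sub>k / 100 + (3/10) q(x\<^sub>i)\<close>. When \<open>p\<close> and \<open>q\<close> have slopes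
  \<open>s\<close> and \<open>t\<close>, the largest singular value is about \<open>sqrt (1 + (3s)\<^sup>2)\<close> and is governed by the \<open>j\<close>-shear
  alone, while the smallest is about \<open>1 / (100 sqrt (1 + (3t)\<^sup>2))\<close> and is governed by the \<open>k\<close>-shear alone.
  The distortion is thus close to the product \<open>100 sqrt (1 + 9s\<^sup>2) sqrt (1 + 9t\<^sup>2)\<close>. Averaging the slopes
  \<open>(2, 0)\<close> and \<open>(0, 2)\<close>, for which it is at most \<open>700\<close>, gives \<open>(1, 1)\<close>, for which it is at least
  \<open>1000 > sqrt 2 \<cdot> 700\<close>. The oscillation between the two slopes is realised by a sawtooth \<open>\<psi>\<close> of slope
  \<open>\<plusminus>1\<close> and small amplitude, with \<open>p(t) = t + \<psi>(t)\<close> and \<open>q(t) = t - \<psi>(t)\<close>.\<close>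

section \<open>Linear distortion\<close>

lemma eventually_sphere_at_right:
  fixes x :: "'a::metric_space"
  assumes "\<forall>\<^sub>F y in nhds x. P y"
  shows "\<forall>\<^sub>F r in at_right 0. 0 < r \<and> (\<forall>y\<in>sphere x r. P y)"
proof -
  from assms obtain d where d: "d > 0" "\<And>y. dist y x < d \<Longrightarrow> P y"
    by (auto simp: eventually_nhds_metric)
  have "\<forall>\<^sub>F r in at_right 0. r \<in> {0<..<d}"
    using d(1) by (rule eventually_at_right_real)
  then show ?thesis
    by eventually_elim (auto intro!: d(2) simp: dist_commute)
qed

text \<open>On small spheres the supremum is at most \<open>L * r\<close> and the infimum at least
  \<open>l * r\<close>, so the radius cancels.\<close>

lemma linear_distortion_at_le:
  fixes f :: "real ^ 'n \<Rightarrow> real ^ 'n"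
  assumes "l > 0"
    and lo: "\<forall>\<^sub>F y in nhds x. l * dist x y \<le> dist (f x) (f y)"
    and up: "\<forall>\<^sub>F y in nhds x. dist (f x) (f y) \<le> L * dist x y"
  shows "linear_distortion_at f x \<le> ereal (L / l)"
  unfolding linear_distortion_at_def
proof (rule Limsup_bounded)
  from eventually_sphere_at_right[OF eventually_conj[OF lo up]]
  show "\<forall>\<^sub>F r in at_right 0. ereal ((SUP y\<in>sphere x r. dist (f x) (f y)) /
          (INF y\<in>sphere x r. dist (f x) (f y))) \<le> ereal (L / l)"
  proof eventually_elim
    case (elim r)
    then have ne: "sphere x r \<noteq> {}" by simp
    then obtain z where z: "z \<in> sphere x r" by blast
    have "(SUP y\<in>sphere x r. dist (f x) (f y)) \<le> L * r"
      using elim by (intro cSUP_least[OF ne]) auto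
    moreover have "l * r \<le> (INF y\<in>sphere x r. dist (f x) (f y))"
      using elim by (intro cINF_greatest[OF ne]) auto
    \<comment> \<open>The monotonicity of quotients needs a nonnegative numerator; the sign comes
      from the upper bound at \<open>z\<close>.\<close>
    moreover have "0 \<le> L * r"
      using elim z order_trans[OF zero_le_dist] by fastforce
    moreover have "0 < l * r" using elim assms(1) by simp
    ultimately have "(SUP y\<in>sphere x r. dist (f x) (f y)) /
        (INF y\<in>sphere x r. dist (f x) (f y)) \<le> (L * r) / (l * r)"
      by (intro frac_le)
    then show ?case using elim by simp
  qed
qed

text \<open>The stretched vector \<open>u\<close> and the shrunk vector \<open>w\<close>, rescaled
  to the sphere, test the supremum and the infimum. The bound by \<open>l\<close> keeps the infimum
  positive, so the quotient is a genuine one.\<close>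

lemma linear_distortion_at_ge:
  fixes T :: "real ^ 'n \<Rightarrow> real ^ 'n"
  assumes "linear T" "l > 0" "m \<ge> 0" "c > 0"
    and lo: "\<And>v. l * norm v \<le> norm (T v)"
    and u: "u \<noteq> 0" "norm (T u) \<ge> m * norm u"
    and w: "w \<noteq> 0" "norm (T w) \<le> c * norm w"
  shows "linear_distortion_at T 0 \<ge> ereal (m / c)"
proof -
  interpret linear T by fact
  have "ereal (m / c) \<le> ereal ((SUP y\<in>sphere 0 r. dist (T 0) (T y)) /
      (INF y\<in>sphere 0 r. dist (T 0) (T y)))" if r: "r > 0" for r
  proof -
    define U where "U = (r / norm u) *\<^sub>R u"
    define W where "W = (r / norm w) *\<^sub>R w"
    have mem: "U \<in> sphere 0 r" "W \<in> sphere 0 r"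
      using r u(1) w(1) by (auto simp: U_def W_def)
    have "norm (T U) = r * (norm (T u) / norm u)"
      using r by (simp add: U_def scale)
    then have U: "m * r \<le> norm (T U)"
      using u r by (simp add: mult.commute pos_le_divide_eq)
    have "norm (T W) = r * (norm (T w) / norm w)"
      using r by (simp add: W_def scale)
    then have W: "norm (T W) \<le> c * r"
      using w r by (simp add: mult.commute pos_divide_le_eq)
    obtain B where B: "\<And>v. norm (T v) \<le> norm v * B"
      using bounded_linear.bounded[OF linear_conv_bounded_linear[THEN iffD1, OF assms(1)]] by blast
    have "m * r \<le> (SUP y\<in>sphere 0 r. dist (T 0) (T y))"
    proof (rule cSUP_upper2[OF _ mem(1)])
      show "bdd_above ((\<lambda>y. dist (T 0) (T y)) ` sphere 0 r)"
        by (rule bdd_aboveI2[of _ _ "r * B"]) (use B in auto)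
    qed (use U in auto)
    moreover have "(INF y\<in>sphere 0 r. dist (T 0) (T y)) \<le> c * r"
    proof (rule cINF_lower2[OF _ mem(2)])
      show "bdd_below ((\<lambda>y. dist (T 0) (T y)) ` sphere 0 r)"
        by (rule bdd_belowI2[of _ 0]) auto
    qed (use W in auto)
    moreover have "l * r \<le> (INF y\<in>sphere 0 r. dist (T 0) (T y))"
    proof (rule cINF_greatest)
      fix y assume "y \<in> sphere (0 :: real ^ 'n) r"
      then show "l * r \<le> dist (T 0) (T y)" using lo[of y] by simp
    qed (use mem(1) in blast)
    moreover have "0 < l * r" "0 \<le> m * r" using r assms by auto
    ultimately have "(m * r) / (c * r) \<le> (SUP y\<in>sphere 0 r. dist (T 0) (T y)) /
        (INF y\<in>sphere 0 r. dist (T 0) (T y))"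
      by (intro frac_le) auto
    then show ?thesis using r by simp
  qed
  then have "\<forall>\<^sub>F r in at_right 0. ereal (m / c) \<le> ereal ((SUP y\<in>sphere 0 r. dist (T 0) (T y)) /
      (INF y\<in>sphere 0 r. dist (T 0) (T y)))"
    by (auto simp: eventually_at_filter)
  from Limsup_mono[OF this] show ?thesis
    unfolding linear_distortion_at_def by (simp add: Limsup_const)
qed

text \<open>Only distances from \<open>x\<close> enter the distortion, so a local formula for them
  transfers it to \<open>T\<close> at the origin.\<close>

lemma linear_distortion_at_eq_linear:
  fixes f T :: "real ^ 'n \<Rightarrow> real ^ 'n"
  assumes "\<forall>\<^sub>F y in nhds x. dist (f x) (f y) = norm (T (y - x))" and "T 0 = 0"
  shows "linear_distortion_at f x = linear_distortion_at T 0"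
  unfolding linear_distortion_at_def
proof (rule Limsup_eq)
  from eventually_sphere_at_right[OF assms(1)]
  show "\<forall>\<^sub>F r in at_right 0.
      ereal ((SUP y\<in>sphere x r. dist (f x) (f y)) / (INF y\<in>sphere x r. dist (f x) (f y))) =
      ereal ((SUP y\<in>sphere 0 r. dist (T 0) (T y)) / (INF y\<in>sphere 0 r. dist (T 0) (T y)))"
  proof eventually_elim
    case (elim r)
    have "sphere 0 r = (\<lambda>y. y - x) ` sphere x r"
      by (auto simp: dist_norm norm_minus_commute image_iff intro!: bexI[of _ "_ + x"])
    then have "(\<lambda>y. dist (T 0) (T y)) ` sphere 0 r = (\<lambda>y. dist (f x) (f y)) ` sphere x r"
      using elim assms(2) by (auto simp: image_image intro!: image_cong)
    then show ?case by simp
  qed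
qed

text \<open>Quasiconformality asks for a bound at every point, including the creases of a piecewise
  affine map. The bilipschitz constants give \<open>L / l\<close> everywhere.\<close>

lemma bilipschitz_imp_quasiconformal_on_UNIV:
  fixes f :: "real ^ 'n \<Rightarrow> real ^ 'n"
  assumes "l > 0" and lo: "\<And>x y. l * dist x y \<le> dist (f x) (f y)"
    and up: "\<And>x y. dist (f x) (f y) \<le> L * dist x y" and "surj f"
  shows "quasiconformal_on UNIV f"
proof -
  have "inj f"
    using lo assms(1) by (intro injI) (metis dist_eq_0_iff mult_le_0_iff not_le zero_less_dist_iff)
  have "homeomorphism UNIV UNIV f (inv f)"
  proof (rule homeomorphismI)
    show "continuous_on UNIV f"
    proof (rule lipschitz_on_continuous_on)
      \<comment> \<open>\<open>axis undefined 1\<close> serves as some unit vector.\<close>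
      have "0 \<le> L" using order_trans[OF zero_le_dist up[of 0 "axis undefined 1"]]
        by (simp add: norm_axis_1 zero_le_mult_iff dist_norm)
      then show "L-lipschitz_on UNIV f" using up by (intro lipschitz_onI) auto
    qed
    have "dist (inv f x) (inv f y) \<le> (1 / l) * dist x y" for x y
      using lo[of "inv f x" "inv f y"] assms by (simp add: surj_f_inv_f field_simps)
    then show "continuous_on UNIV (inv f)"
      using assms(1) by (intro lipschitz_on_continuous_on[of "1 / l"] lipschitz_onI) auto
  qed (use \<open>inj f\<close> \<open>surj f\<close> in \<open>auto simp: surj_f_inv_f\<close>)
  moreover have "linear_distortion_at f x \<le> ereal (L / l)" for x
    using assms by (intro linear_distortion_at_le) auto
  ultimately show ?thesis
    unfolding quasiconformal_on_def using assms(4) by auto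
qed

lemma linear_distortion_const:
  assumes "\<And>x. linear_distortion_at f x = (d :: ereal)"
  shows "linear_distortion UNIV f = d"
proof -
  have "linear_distortion_at f = (\<lambda>x. d)" using assms by auto
  then show ?thesis
    by (simp add: linear_distortion_def lebesgue_on_UNIV_eq esssup_const)
qed

text \<open>Lebesgue measure is complete, so values on a null set cannot spoil measurability. This
  matters because \<open>esssup\<close> of a nonmeasurable function is \<infinity> by
  definition.\<close>

lemma borel_measurable_lebesgue_off_negligible:
  fixes g h :: "'a::euclidean_space \<Rightarrow> 'b::topological_space"
  assumes "h \<in> borel_measurable lebesgue" "negligible S" "\<And>x. x \<notin> S \<Longrightarrow> g x = h x"
  shows "g \<in> borel_measurable lebesgue"
proof (rule measurableI)
  fix A :: "'b set" assume A: "A \<in> sets borel"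
  have "negligible (g -` A \<inter> S)"
    using assms(2) by (rule negligible_subset) auto
  then have "g -` A \<inter> S \<in> sets lebesgue"
    by (simp add: negligible_imp_sets)
  moreover have "h -` A - S \<in> sets lebesgue"
    using measurable_sets[OF assms(1) A] negligible_imp_sets[OF assms(2)] by auto
  moreover have "g -` A \<inter> space lebesgue = (h -` A - S) \<union> (g -` A \<inter> S)"
    using assms(3) by auto
  ultimately show "g -` A \<inter> space lebesgue \<in> sets lebesgue" by (simp only: sets.Un)
qed auto

section \<open>The sawtooth\<close>

text \<open>The distance to the nearest integer, rescaled to period \<open>1 / N\<close> with slopes
  still 1 and -1. For \<open>N = 0\<close> it is 0, as division by zero gives 0.\<close>

definition sawtooth :: "nat \<Rightarrow> real \<Rightarrow> real" where
  "sawtooth N t = infdist (real N * t) \<int> / real N"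

lemma abs_sawtooth_diff_le: "\<bar>sawtooth N s - sawtooth N t\<bar> \<le> \<bar>s - t\<bar>"
proof (cases "N = 0")
  case False
  have "\<bar>sawtooth N s - sawtooth N t\<bar> = \<bar>infdist (real N * s) \<int> - infdist (real N * t) \<int>\<bar> / real N"
    by (simp add: sawtooth_def diff_divide_distrib[symmetric])
  also have "\<dots> \<le> dist (real N * s) (real N * t) / real N"
    by (intro divide_right_mono infdist_triangle_abs) auto
  also have "\<dots> = \<bar>s - t\<bar>"
    using False by (simp add: dist_real_def right_diff_distrib[symmetric] abs_mult)
  finally show ?thesis .
qed (simp add: sawtooth_def)

lemma abs_sawtooth_le: "\<bar>sawtooth N t\<bar> \<le> 1 / real N"
proof -
  have "infdist (real N * t) \<int> \<le> dist (real N * t) \<lfloor>real N * t\<rfloor>"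
    by (intro infdist_le) auto
  also have "\<dots> \<le> 1" unfolding dist_real_def by linarith
  finally show ?thesis
    by (simp add: sawtooth_def infdist_nonneg divide_right_mono)
qed

text \<open>No integer lies strictly between \<open>n\<close> and \<open>n + 1\<close>, so one of
  the two endpoints is nearest.\<close>

lemma infdist_Ints:
  fixes t :: real
  assumes "of_int n \<le> t" "t \<le> of_int n + 1"
  shows "infdist t \<int> = min (t - of_int n) (of_int n + 1 - t)"
proof (rule antisym)
  have "infdist t \<int> \<le> dist t (of_int n)" "infdist t \<int> \<le> dist t (of_int (n + 1))"
    by (intro infdist_le Ints_of_int)+
  with assms show "infdist t \<int> \<le> min (t - of_int n) (of_int n + 1 - t)"
    by (auto simp: dist_real_def)
  have "min (t - of_int n) (of_int n + 1 - t) \<le> dist t a" if "a \<in> \<int>" for a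
  proof -
    from that obtain m where m: "a = of_int m" by (auto elim: Ints_cases)
    have "m \<le> n \<or> n + 1 \<le> m" by linarith
    then have "a \<le> of_int n \<or> of_int n + 1 \<le> a"
      unfolding m by (metis of_int_1 of_int_add of_int_le_iff)
    with assms show ?thesis by (auto simp: dist_real_def)
  qed
  then show "min (t - of_int n) (of_int n + 1 - t) \<le> infdist t \<int>"
    by (subst infdist_notempty) (auto intro!: cINF_greatest)
qed

section \<open>Affine pieces of the sawtooth and the null set of its breakpoints\<close>

definition rising :: "nat \<Rightarrow> real set" where
  "rising N = (\<Union>n::int. {t. of_int n < real N * t \<and> real N * t < of_int n + 1 / 2})"

definition falling :: "nat \<Rightarrow> real set" where
  "falling N = (\<Union>n::int. {t. of_int n + 1 / 2 < real N * t \<and> real N * t < of_int n + 1})"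

lemma open_rising: "open (rising N)"
  unfolding rising_def by (intro open_UN ballI open_Collect_conj open_Collect_less continuous_intros)

lemma sawtooth_rising:
  assumes "t \<in> rising N"
  shows "\<forall>\<^sub>F s in nhds t. sawtooth N s - sawtooth N t = s - t"
proof -
  obtain n :: int where n: "of_int n < real N * t" "real N * t < of_int n + 1 / 2"
    using assms by (auto simp: rising_def)
  then have "N > 0" by (cases "N = 0") auto
  have *: "sawtooth N s = s - of_int n / real N"
    if "of_int n < real N * s" "real N * s < of_int n + 1 / 2" for s
    using that \<open>N > 0\<close> by (simp add: sawtooth_def infdist_Ints[of n] min_def field_simps)
  have "open {s. of_int n < real N * s \<and> real N * s < of_int n + 1 / 2}"
    by (intro open_Collect_conj open_Collect_less continuous_intros)
  from eventually_nhds_in_open[OF this, of t] n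
  have "\<forall>\<^sub>F s in nhds t. s \<in> {s. of_int n < real N * s \<and> real N * s < of_int n + 1 / 2}" by simp
  then show ?thesis
    by eventually_elim (simp add: * n)
qed

lemma sawtooth_falling:
  assumes "t \<in> falling N"
  shows "\<forall>\<^sub>F s in nhds t. sawtooth N s - sawtooth N t = t - s"
proof -
  obtain n :: int where n: "of_int n + 1 / 2 < real N * t" "real N * t < of_int n + 1"
    using assms by (auto simp: falling_def)
  \<comment> \<open>For \<open>N = 0\<close> the integer \<open>n\<close> would satisfy
    \<open>n + 1 / 2 < 0 < n + 1\<close>.\<close>
  have "N \<noteq> 0"
  proof
    assume "N = 0"
    with n have "n < 0" "n > - 1" by auto
    then show False by simp
  qed
  then have "N > 0" by simp
  have *: "sawtooth N s = (of_int n + 1) / real N - s"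
    if "of_int n + 1 / 2 < real N * s" "real N * s < of_int n + 1" for s
    using that \<open>N > 0\<close> by (simp add: sawtooth_def infdist_Ints[of n] min_def field_simps)
  have "open {s. of_int n + 1 / 2 < real N * s \<and> real N * s < of_int n + 1}"
    by (intro open_Collect_conj open_Collect_less continuous_intros)
  from eventually_nhds_in_open[OF this, of t] n
  have "\<forall>\<^sub>F s in nhds t. s \<in> {s. of_int n + 1 / 2 < real N * s \<and> real N * s < of_int n + 1}" by simp
  then show ?thesis
    by eventually_elim (simp add: * n)
qed

text \<open>The remaining points are breakpoints, all of them multiples of
  \<open>1 / (2 * N)\<close>.\<close>

lemma countable_compl_rising_falling:
  assumes "N > 0"
  shows "countable (- (rising N \<union> falling N))"
proof (rule countable_subset)
  show "countable ((\<lambda>m::int. of_int m / (2 * real N)) ` UNIV)" by simp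
  show "- (rising N \<union> falling N) \<subseteq> (\<lambda>m::int. of_int m / (2 * real N)) ` UNIV"
  proof
    fix t assume t: "t \<in> - (rising N \<union> falling N)"
    define n where "n = \<lfloor>real N * t\<rfloor>"
    have "of_int n \<le> real N * t" "real N * t < of_int n + 1" unfolding n_def by linarith+
    moreover have "\<not> (of_int n < real N * t \<and> real N * t < of_int n + 1 / 2)"
      "\<not> (of_int n + 1 / 2 < real N * t \<and> real N * t < of_int n + 1)"
      using t by (auto simp: rising_def falling_def)
    ultimately have "real N * t = of_int n \<or> real N * t = of_int n + 1 / 2" by linarith
    then have "2 * real N * t = of_int (2 * n) \<or> 2 * real N * t = of_int (2 * n + 1)" by auto
    then have "t = of_int (2 * n) / (2 * real N) \<or> t = of_int (2 * n + 1) / (2 * real N)"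
      using assms by (auto simp: eq_divide_eq mult.commute)
    then show "t \<in> (\<lambda>m::int. of_int m / (2 * real N)) ` UNIV" by blast
  qed
qed

lemma negligible_component_countable:
  fixes i :: "'n::finite"
  assumes "countable S"
  shows "negligible {x :: real ^ 'n. x $ i \<in> S}"
proof -
  have "{x :: real ^ 'n. x $ i \<in> S} = \<Union> ((\<lambda>c. {x. x \<bullet> axis i 1 = c}) ` S)"
    by (auto simp: inner_axis)
  moreover have "negligible (\<Union> ((\<lambda>c. {x :: real ^ 'n. x \<bullet> axis i 1 = c}) ` S))"
    using assms
    by (intro negligible_countable_Union) (auto intro!: negligible_standard_hyperplane simp: axis_in_Basis_iff)
  ultimately show ?thesis by simp
qed

section \<open>The shears\<close>

text \<open>The profiles \<open>p\<close> and \<open>q\<close> are arbitrary functions, so the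
  laminates, their linear pieces and the increments of both are all instances.\<close>

definition shear :: "'n \<Rightarrow> 'n \<Rightarrow> 'n \<Rightarrow> (real \<Rightarrow> real) \<Rightarrow> (real \<Rightarrow> real) \<Rightarrow> real ^ 'n \<Rightarrow> real ^ 'n" where
  "shear i j k p q x = (\<chi> m. if m = i then x $ i / 10
     else if m = j then x $ j + 3 * p (x $ i)
     else if m = k then x $ k / 100 + 3 / 10 * q (x $ i) else x $ m)"

lemma norm_square_three_components:
  fixes v :: "real ^ 'n"
  assumes "distinct [i, j, k]"
  shows "(norm v)\<^sup>2 = (v $ i)\<^sup>2 + (v $ j)\<^sup>2 + (v $ k)\<^sup>2 + (\<Sum>m\<in>- {i, j, k}. (v $ m)\<^sup>2)"
proof -
  have "(norm v)\<^sup>2 = (\<Sum>m\<in>UNIV. (v $ m)\<^sup>2)"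
    by (simp add: norm_vec_def L2_set_def sum_nonneg)
  also have "\<dots> = (\<Sum>m\<in>{i, j, k}. (v $ m)\<^sup>2) + (\<Sum>m\<in>- {i, j, k}. (v $ m)\<^sup>2)"
    by (subst sum.union_disjoint[symmetric]) auto
  finally show ?thesis using assms by simp
qed

text \<open>Increments are again shears, with constant profiles. A norm estimate at a single vector
  thereby becomes a bilipschitz estimate.\<close>

lemma shear_diff:
  "shear i j k p q y - shear i j k p q x =
     shear i j k (\<lambda>_. p (y $ i) - p (x $ i)) (\<lambda>_. q (y $ i) - q (x $ i)) (y - x)"
  by (simp add: shear_def vec_eq_iff field_simps)

lemma shear_cong:
  "p (x $ i) = p' (x $ i) \<Longrightarrow> q (x $ i) = q' (x $ i) \<Longrightarrow> shear i j k p q x = shear i j k p' q' x"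
  by (simp add: shear_def vec_eq_iff)

lemma linear_shear: "linear (shear i j k (\<lambda>t. a * t) (\<lambda>t. b * t))"
  by (rule linearI) (simp_all add: shear_def vec_eq_iff algebra_simps)

lemma surj_shear:
  assumes "distinct [i, j, k]"
  shows "surj (shear i j k p q)"
proof
  show "UNIV \<subseteq> range (shear i j k p q)"
  proof
    fix y :: "real ^ 'a"
    \<comment> \<open>The system is triangular: the \<open>i\<close>-th coordinate is solved first,
      then the other two.\<close>
    have "y = shear i j k p q (\<chi> m. if m = i then 10 * y $ i
        else if m = j then y $ j - 3 * p (10 * y $ i)
        else if m = k then 100 * y $ k - 30 * q (10 * y $ i) else y $ m)"
      using assms by (auto simp: shear_def vec_eq_iff diff_divide_distrib)
    then show "y \<in> range (shear i j k p q)" by blast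
  qed
qed simp

lemma norm_square_shear:
  fixes v :: "real ^ 'n"
  assumes "distinct [i, j, k]"
  shows "(norm (shear i j k p q v))\<^sup>2 = (v $ i / 10)\<^sup>2 + (v $ j + 3 * p (v $ i))\<^sup>2 +
    (v $ k / 100 + 3 / 10 * q (v $ i))\<^sup>2 + (\<Sum>m\<in>- {i, j, k}. (v $ m)\<^sup>2)"
proof -
  have "(\<Sum>m\<in>- {i, j, k}. (shear i j k p q v $ m)\<^sup>2) = (\<Sum>m\<in>- {i, j, k}. (v $ m)\<^sup>2)"
    by (rule sum.cong) (auto simp: shear_def)
  with assms show ?thesis
    unfolding norm_square_three_components[OF assms] by (auto simp: shear_def)
qed

section \<open>Norm estimates and distortion of the shears\<close>

lemma mult_norm_le_by_squares:
  fixes l :: real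
  assumes "l \<ge> 0" "l\<^sup>2 * (norm v)\<^sup>2 \<le> (norm w)\<^sup>2"
  shows "l * norm v \<le> norm w"
  using assms by (metis norm_ge_zero power2_le_imp_le power_mult_distrib)

text \<open>Cauchy-Schwarz for \<open>(1, c)\<close> and \<open>(x, y)\<close>. Applied to a sheared
  coordinate with \<open>c\<close> negated, it also bounds the original coordinate, hence yields
  lower bounds.\<close>

lemma power2_add_le_weighted: "(x + c * y)\<^sup>2 \<le> (1 + c\<^sup>2) * (x\<^sup>2 + y\<^sup>2)" for x y c :: real
proof -
  have "(1 + c\<^sup>2) * (x\<^sup>2 + y\<^sup>2) - (x + c * y)\<^sup>2 = (c * x - y)\<^sup>2"
    by (simp add: power2_eq_square algebra_simps)
  then show ?thesis by (smt (verit) zero_le_power2)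
qed

text \<open>Crude constants, enough for quasiconformality but not for the sharp distortion. The
  profiles are constrained at \<open>v $ i\<close> only, so the constant profiles of
  \<open>shear_diff\<close> qualify.\<close>

lemma shear_bounds:
  fixes v :: "real ^ 'n"
  assumes "distinct [i, j, k]" and "\<bar>p (v $ i)\<bar> \<le> 2 * \<bar>v $ i\<bar>" and "\<bar>q (v $ i)\<bar> \<le> 2 * \<bar>v $ i\<bar>"
  shows "1 / 1000 * norm v \<le> norm (shear i j k p q v)" "norm (shear i j k p q v) \<le> 10 * norm v"
proof -
  define a b c P Q R where "a = v $ i" "b = v $ j" "c = v $ k" "P = p (v $ i)" "Q = q (v $ i)"
    "R = (\<Sum>m\<in>- {i, j, k}. (v $ m)\<^sup>2)"
  note defs = this
  have R: "R \<ge> 0" unfolding defs by (intro sum_nonneg) auto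
  have PQ: "P\<^sup>2 \<le> 4 * a\<^sup>2" "Q\<^sup>2 \<le> 4 * a\<^sup>2"
    using assms(2,3) abs_le_square_iff[of _ "2 * a"] by (auto simp: defs power_mult_distrib abs_mult)
  have n: "(norm v)\<^sup>2 = a\<^sup>2 + b\<^sup>2 + c\<^sup>2 + R"
    unfolding norm_square_three_components[OF assms(1)] defs ..
  have s: "(norm (shear i j k p q v))\<^sup>2 = (a / 10)\<^sup>2 + (b + 3 * P)\<^sup>2 + (c / 100 + 3 / 10 * Q)\<^sup>2 + R"
    unfolding norm_square_shear[OF assms(1)] defs ..
  have "b\<^sup>2 \<le> 10 * ((b + 3 * P)\<^sup>2 + P\<^sup>2)"
    using power2_add_le_weighted[of "b + 3 * P" "- 3" P] by simp
  moreover have "(c / 100)\<^sup>2 \<le> 2 * ((c / 100 + 3 / 10 * Q)\<^sup>2 + (3 / 10 * Q)\<^sup>2)"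
    using power2_add_le_weighted[of "c / 100 + 3 / 10 * Q" "- 1" "3 / 10 * Q"] by simp
  ultimately show "1 / 1000 * norm v \<le> norm (shear i j k p q v)"
    using PQ R
    by (intro mult_norm_le_by_squares, simp, simp add: n s power_divide power_mult_distrib)
      (insert zero_le_power2[of a] zero_le_power2[of "b + 3 * P"]
        zero_le_power2[of "c / 100 + 3 * Q / 10"], linarith)
  have "(b + 3 * P)\<^sup>2 \<le> 10 * (b\<^sup>2 + P\<^sup>2)"
    using power2_add_le_weighted[of b 3 P] by simp
  moreover have "(c / 100 + 3 / 10 * Q)\<^sup>2 \<le> 2 * ((c / 100)\<^sup>2 + (3 / 10 * Q)\<^sup>2)"
    using power2_add_le_weighted[of "c / 100" 1 "3 / 10 * Q"] by simp
  ultimately have "(norm (shear i j k p q v))\<^sup>2 \<le> 10\<^sup>2 * (norm v)\<^sup>2"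
    using PQ R by (simp add: n s power_divide power_mult_distrib)
      (insert zero_le_power2[of a] zero_le_power2[of b] zero_le_power2[of c], linarith)
  then show "norm (shear i j k p q v) \<le> 10 * norm v"
    by (metis norm_ge_zero power2_le_imp_le power_mult_distrib mult_nonneg_nonneg zero_le_numeral)
qed

text \<open>The \<open>j\<close>-shear expands by at most 7, as 37 = 1 + 6 * 6 and 37 + 1/100 is
  below 49. The least stretch stays 1/100, attained along the \<open>k\<close>-axis. Slopes are
  written as \<open>0 * t\<close> to match \<open>linear_shear\<close>.\<close>

lemma linear_distortion_at_shear_rising_le:
  assumes "distinct [i, j, k]"
  shows "linear_distortion_at (shear i j k (\<lambda>t. 2 * t) (\<lambda>t. 0 * t)) 0 \<le> ereal 700"
proof -
  let ?T = "shear i j k (\<lambda>t. 2 * t) (\<lambda>t. 0 * t)"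
  have T0: "?T 0 = 0" by (rule linear_0[OF linear_shear])
  have lo: "1 / 100 * norm v \<le> norm (?T v)" and up: "norm (?T v) \<le> 7 * norm v" for v
  proof -
    define a b c R where "a = v $ i" "b = v $ j" "c = v $ k" "R = (\<Sum>m\<in>- {i, j, k}. (v $ m)\<^sup>2)"
    note defs = this
    have R: "R \<ge> 0" unfolding defs by (intro sum_nonneg) auto
    have n: "(norm v)\<^sup>2 = a\<^sup>2 + b\<^sup>2 + c\<^sup>2 + R"
      unfolding norm_square_three_components[OF assms(1)] defs ..
    have s: "(norm (?T v))\<^sup>2 = (a / 10)\<^sup>2 + (b + 6 * a)\<^sup>2 + (c / 100)\<^sup>2 + R"
      unfolding norm_square_shear[OF assms(1)] defs by simp
    have "b\<^sup>2 \<le> 37 * ((b + 6 * a)\<^sup>2 + a\<^sup>2)"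
      using power2_add_le_weighted[of "b + 6 * a" "- 6" a] by simp
    then show "1 / 100 * norm v \<le> norm (?T v)"
      using R by (intro mult_norm_le_by_squares, simp, unfold n s, simp add: power_divide)
        (insert zero_le_power2[of a] zero_le_power2[of "b + 6 * a"], linarith)
    have "(b + 6 * a)\<^sup>2 \<le> 37 * (b\<^sup>2 + a\<^sup>2)"
      using power2_add_le_weighted[of b 6 a] by simp
    then have "(norm (?T v))\<^sup>2 \<le> 7\<^sup>2 * (norm v)\<^sup>2"
      using R by (unfold n s, simp add: power_divide)
        (insert zero_le_power2[of a] zero_le_power2[of b] zero_le_power2[of c], linarith)
    then show "norm (?T v) \<le> 7 * norm v"
      by (metis norm_ge_zero power2_le_imp_le power_mult_distrib mult_nonneg_nonneg zero_le_numeral)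
  qed
  have "linear_distortion_at ?T 0 \<le> ereal (7 / (1 / 100))"
    by (intro linear_distortion_at_le always_eventually allI)
      (simp_all only: T0 dist_0_norm lo up zero_less_divide_1_iff zero_less_numeral)
  then show ?thesis by simp
qed

text \<open>Here nothing expands, while the \<open>k\<close>-shear worsens the contraction 1/100 by
  a factor of at most 7. In terms of \<open>a / 10\<close> this shear again has slope 6, since 3/10
  * 2 = 6/10, so the weight 37 reappears.\<close>

lemma linear_distortion_at_shear_falling_le:
  assumes "distinct [i, j, k]"
  shows "linear_distortion_at (shear i j k (\<lambda>t. 0 * t) (\<lambda>t. 2 * t)) 0 \<le> ereal 700"
proof -
  let ?T = "shear i j k (\<lambda>t. 0 * t) (\<lambda>t. 2 * t)"
  have T0: "?T 0 = 0" by (rule linear_0[OF linear_shear])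
  have lo: "1 / 700 * norm v \<le> norm (?T v)" and up: "norm (?T v) \<le> 1 * norm v" for v
  proof -
    define a b c R where "a = v $ i" "b = v $ j" "c = v $ k" "R = (\<Sum>m\<in>- {i, j, k}. (v $ m)\<^sup>2)"
    note defs = this
    have R: "R \<ge> 0" unfolding defs by (intro sum_nonneg) auto
    have n: "(norm v)\<^sup>2 = a\<^sup>2 + b\<^sup>2 + c\<^sup>2 + R"
      unfolding norm_square_three_components[OF assms(1)] defs ..
    have s: "(norm (?T v))\<^sup>2 = (a / 10)\<^sup>2 + b\<^sup>2 + (c / 100 + 6 * (a / 10))\<^sup>2 + R"
      unfolding norm_square_shear[OF assms(1)] defs by simp
    have "(c / 100)\<^sup>2 \<le> 37 * ((c / 100 + 6 * (a / 10))\<^sup>2 + (a / 10)\<^sup>2)"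
      using power2_add_le_weighted[of "c / 100 + 6 * (a / 10)" "- 6" "a / 10"] by simp
    then show "1 / 700 * norm v \<le> norm (?T v)"
      using R by (intro mult_norm_le_by_squares, simp, unfold n s, simp add: power_divide)
        (insert zero_le_power2[of a] zero_le_power2[of b]
          zero_le_power2[of "c / 100 + 3 * a / 5"], linarith)
    have "(c / 100 + 6 * (a / 10))\<^sup>2 \<le> 37 * ((c / 100)\<^sup>2 + (a / 10)\<^sup>2)"
      using power2_add_le_weighted[of "c / 100" 6 "a / 10"] by simp
    then have "(norm (?T v))\<^sup>2 \<le> (norm v)\<^sup>2"
      using R by (unfold n s, simp add: power_divide)
        (insert zero_le_power2[of a] zero_le_power2[of b] zero_le_power2[of c], linarith)
    then show "norm (?T v) \<le> 1 * norm v"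
      by (simp add: power2_le_iff_abs_le)
  qed
  have "linear_distortion_at ?T 0 \<le> ereal (1 / (1 / 700))"
    by (intro linear_distortion_at_le always_eventually allI)
      (simp_all only: T0 dist_0_norm lo up zero_less_divide_1_iff zero_less_numeral)
  then show ?thesis by simp
qed

lemma linear_distortion_at_shear_ge:
  assumes "distinct [i, j, k]"
  shows "linear_distortion_at (shear i j k (\<lambda>t. 1 * t) (\<lambda>t. 1 * t)) 0 \<ge> ereal 1000"
proof -
  let ?T = "shear i j k (\<lambda>t. 1 * t) (\<lambda>t. 1 * t)"
  \<comment> \<open>\<open>u\<close> is parallel to the row (3, 1) that produces the
    \<open>j\<close>-th coordinate, which is thus stretched by \<open>sqrt 10\<close>. In
    \<open>w\<close> the entry 90 cancels the \<open>j\<close>-th coordinate of the image, and -30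
    minimises the other two, which become -3 and 1.\<close>
  define u :: "real ^ 'a" where "u = (\<chi> m. if m = i then 3 else if m = j then 1 else 0)"
  define w :: "real ^ 'a" where
    "w = (\<chi> m. if m = i then - 30 else if m = j then 90 else if m = k then 1000 else 0)"
  have u0: "(\<Sum>m\<in>- {i, j, k}. (u $ m)\<^sup>2) = 0" by (rule sum.neutral) (auto simp: u_def)
  have w0: "(\<Sum>m\<in>- {i, j, k}. (w $ m)\<^sup>2) = 0" by (rule sum.neutral) (auto simp: w_def)
  have lo: "1 / 1000 * norm v \<le> norm (?T v)" for v
    using assms by (intro shear_bounds) auto
  have "(norm u)\<^sup>2 = 10" "(norm (?T u))\<^sup>2 \<ge> 100"
    using assms unfolding norm_square_shear[OF assms] norm_square_three_components[OF assms, of u] u0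
    by (auto simp: u_def power2_eq_square)
  then have u: "u \<noteq> 0" "sqrt 10 * norm u \<le> norm (?T u)"
    by (auto intro!: mult_norm_le_by_squares)
  have "(norm w)\<^sup>2 \<ge> 1000\<^sup>2" "(norm (?T w))\<^sup>2 = 10"
    using assms unfolding norm_square_shear[OF assms] norm_square_three_components[OF assms, of w] w0
    by (auto simp: w_def power2_eq_square)
  then have w: "1000 \<le> norm w" "norm (?T w) = sqrt 10"
    by (auto intro: power2_le_imp_le simp: real_sqrt_unique[symmetric])
  then have "w \<noteq> 0" by auto
  have "ereal (sqrt 10 / (sqrt 10 / 1000)) \<le> linear_distortion_at ?T 0"
    by (rule linear_distortion_at_ge[OF linear_shear _ _ _ lo u \<open>w \<noteq> 0\<close>]) (use w in auto)
  then show ?thesis by simp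
qed

section \<open>The laminates\<close>

definition laminate :: "'n \<Rightarrow> 'n \<Rightarrow> 'n \<Rightarrow> nat \<Rightarrow> real ^ 'n \<Rightarrow> real ^ 'n" where
  "laminate i j k N = shear i j k (\<lambda>t. t + sawtooth N t) (\<lambda>t. t - sawtooth N t)"

lemma quasiconformal_laminate:
  fixes i j k :: "'n::finite"
  assumes "distinct [i, j, k]"
  shows "quasiconformal_on UNIV (laminate i j k N)" "surj (laminate i j k N)"
proof -
  let ?f = "laminate i j k N"
  show "surj ?f" unfolding laminate_def using assms by (rule surj_shear)
  have "1 / 1000 * dist x y \<le> dist (?f x) (?f y) \<and> dist (?f x) (?f y) \<le> 10 * dist x y" for x y
  proof -
    have "1 / 1000 * norm (y - x) \<le> norm (?f y - ?f x) \<and> norm (?f y - ?f x) \<le> 10 * norm (y - x)"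
      \<comment> \<open>Adding or subtracting a 1-Lipschitz function from the identity gives a
        2-Lipschitz profile, as \<open>shear_bounds\<close> requires.\<close>
      unfolding laminate_def shear_diff using abs_sawtooth_diff_le[of N "y $ i" "x $ i"]
      by (intro conjI shear_bounds assms) (auto simp: abs_if split: if_splits)
    then show ?thesis by (simp add: dist_norm norm_minus_commute)
  qed
  then show "quasiconformal_on UNIV ?f"
    using \<open>surj ?f\<close> by (intro bilipschitz_imp_quasiconformal_on_UNIV[of "1 / 1000" _ 10]) auto
qed

text \<open>Near such points the sawtooth has slope 1 or -1, so one profile has slope 2 and the
  other is locally constant.\<close>

lemma linear_distortion_at_laminate:
  fixes x :: "real ^ 'n::finite"
  shows "x $ i \<in> rising N \<Longrightarrow> linear_distortion_at (laminate i j k N) x =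
      linear_distortion_at (shear i j k (\<lambda>t. 2 * t) (\<lambda>t. 0 * t)) 0"
    and "x $ i \<in> falling N \<Longrightarrow> linear_distortion_at (laminate i j k N) x =
      linear_distortion_at (shear i j k (\<lambda>t. 0 * t) (\<lambda>t. 2 * t)) 0"
proof -
  have lim: "filterlim (\<lambda>y. y $ i) (nhds (x $ i)) (nhds x)"
    by (intro tendsto_intros filterlim_ident)
  have d: "dist (laminate i j k N x) (laminate i j k N y) = norm (laminate i j k N y - laminate i j k N x)" for y
    by (simp add: dist_norm norm_minus_commute)
  show "linear_distortion_at (laminate i j k N) x =
      linear_distortion_at (shear i j k (\<lambda>t. 2 * t) (\<lambda>t. 0 * t)) 0" if "x $ i \<in> rising N"
  proof (rule linear_distortion_at_eq_linear)
    show "\<forall>\<^sub>F y in nhds x. dist (laminate i j k N x) (laminate i j k N y) =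
        norm (shear i j k (\<lambda>t. 2 * t) (\<lambda>t. 0 * t) (y - x))"
      using lim[unfolded filterlim_iff, rule_format, OF sawtooth_rising[OF that]]
      by eventually_elim
        (unfold d, unfold laminate_def shear_diff, auto intro!: arg_cong[of _ _ norm] shear_cong)
  qed (rule linear_0[OF linear_shear])
  show "linear_distortion_at (laminate i j k N) x =
      linear_distortion_at (shear i j k (\<lambda>t. 0 * t) (\<lambda>t. 2 * t)) 0" if "x $ i \<in> falling N"
  proof (rule linear_distortion_at_eq_linear)
    show "\<forall>\<^sub>F y in nhds x. dist (laminate i j k N x) (laminate i j k N y) =
        norm (shear i j k (\<lambda>t. 0 * t) (\<lambda>t. 2 * t) (y - x))"
      using lim[unfolded filterlim_iff, rule_format, OF sawtooth_falling[OF that]]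
      by eventually_elim
        (unfold d, unfold laminate_def shear_diff, auto intro!: arg_cong[of _ _ norm] shear_cong)
  qed (rule linear_0[OF linear_shear])
qed

lemma linear_distortion_laminate:
  fixes i j k :: "'n::finite"
  assumes "distinct [i, j, k]" "N > 0"
  shows "AE x in lebesgue. linear_distortion_at (laminate i j k N) x \<le> ereal 700"
    and "linear_distortion UNIV (laminate i j k N) \<le> ereal 700"
proof -
  define S where "S = {x :: real ^ 'n. x $ i \<in> - (rising N \<union> falling N)}"
  have S: "negligible S"
    unfolding S_def using assms(2)
    by (intro negligible_component_countable countable_compl_rising_falling)
  have "linear_distortion_at (laminate i j k N) x \<le> ereal 700" if "x \<notin> S" for x
    using that linear_distortion_at_shear_rising_le[OF assms(1)]
      linear_distortion_at_shear_falling_le[OF assms(1)] linear_distortion_at_laminate[of x i N j k]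
    by (auto simp: S_def)
  then show AE: "AE x in lebesgue. linear_distortion_at (laminate i j k N) x \<le> ereal 700"
    using S by (intro AE_I'[of S]) (auto simp: negligible_iff_null_sets)
  \<comment> \<open>A two-valued Borel function that agrees with the distortion off
    \<open>S\<close>, where a point that is not rising is falling.\<close>
  define h :: "real ^ 'n \<Rightarrow> ereal" where
    "h x = (if x $ i \<in> rising N then linear_distortion_at (shear i j k (\<lambda>t. 2 * t) (\<lambda>t. 0 * t)) 0
      else linear_distortion_at (shear i j k (\<lambda>t. 0 * t) (\<lambda>t. 2 * t)) 0)" for x
  have "open ((\<lambda>x :: real ^ 'n. x $ i) -` rising N)"
    by (intro open_vimage open_rising continuous_intros)
  then have "h \<in> borel_measurable borel"
    unfolding h_def by (intro measurable_If) (auto simp: vimage_def)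
  then have "h \<in> borel_measurable lebesgue"
    by (intro measurable_completion) simp
  then have "linear_distortion_at (laminate i j k N) \<in> borel_measurable lebesgue"
    using S by (rule borel_measurable_lebesgue_off_negligible)
      (auto simp: S_def h_def linear_distortion_at_laminate)
  with AE show "linear_distortion UNIV (laminate i j k N) \<le> ereal 700"
    unfolding linear_distortion_def lebesgue_on_UNIV_eq by (intro esssup_I)
qed

text \<open>The difference is the sawtooth times a fixed vector of norm at most 3 + 3/10, so
  convergence is uniform on the whole space. The shift by \<open>Suc\<close> avoids the degenerate
  index 0.\<close>

lemma uniform_limit_laminate:
  fixes i j k :: "'n::finite"
  assumes "distinct [i, j, k]"
  shows "uniform_limit K (\<lambda>N. laminate i j k (Suc N)) (shear i j k (\<lambda>t. 1 * t) (\<lambda>t. 1 * t)) sequentially"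
proof (rule uniform_limitI)
  fix e :: real assume "e > 0"
  let ?A = "shear i j k (\<lambda>t. 1 * t) (\<lambda>t. 1 * t)"
  have bound: "dist (laminate i j k N x) (?A x) \<le> 4 * (1 / real N)" for N and x :: "real ^ 'n"
  proof -
    have "laminate i j k N x - ?A x =
        sawtooth N (x $ i) *\<^sub>R (3 *\<^sub>R axis j 1 - (3 / 10) *\<^sub>R axis k 1)"
      using assms by (auto simp: laminate_def shear_def vec_eq_iff axis_def field_simps)
    moreover have "norm (3 *\<^sub>R axis j 1 - (3 / 10) *\<^sub>R axis k 1 :: real ^ 'n) \<le> 4"
      by (rule order_trans[OF norm_triangle_ineq4]) simp
    ultimately have "norm (laminate i j k N x - ?A x) \<le> (1 / real N) * 4"
      by (simp only: norm_scaleR) (intro mult_mono abs_sawtooth_le, auto)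
    then show ?thesis by (simp add: dist_norm)
  qed
  have "(\<lambda>N. 4 * (1 / real (Suc N))) \<longlonglongrightarrow> 4 * 0"
    by (intro tendsto_intros LIMSEQ_Suc lim_1_over_n)
  from order_tendstoD(2)[OF this] \<open>e > 0\<close>
  have "\<forall>\<^sub>F N in sequentially. 4 * (1 / real (Suc N)) < e" by simp
  then show "\<forall>\<^sub>F N in sequentially. \<forall>x\<in>K. dist (laminate i j k (Suc N) x) (?A x) < e"
    by eventually_elim (use bound in \<open>blast intro: le_less_trans\<close>)
qed

theorem theorem5:
  fixes \<alpha> :: real
  assumes "CARD('n::finite) \<ge> 3"
    and "\<alpha> < sqrt 2"
  shows "\<exists>(H::real) (A :: real ^ 'n \<Rightarrow> real ^ 'n) (f :: nat \<Rightarrow> real ^ 'n \<Rightarrow> real ^ 'n).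
           invertible_affine A \<and>
           (\<forall>j. quasiconformal_on UNIV (f j) \<and> range (f j) = UNIV) \<and>
           (\<forall>j. AE x in lebesgue. linear_distortion_at (f j) x \<le> ereal H) \<and>
           (\<forall>j. linear_distortion UNIV (f j) \<le> ereal H) \<and>
           locally_uniform_limit f A \<and>
           (\<forall>x. linear_distortion_at A x = linear_distortion UNIV A) \<and>
           linear_distortion UNIV A \<ge> ereal (\<alpha> * H)"
proof -
  obtain S :: "'n set" where "card S = 3"
    using obtain_subset_with_card_n[OF assms(1)] by blast
  then obtain i j k :: 'n where ijk: "distinct [i, j, k]"
    by (auto simp: card_3_iff)
  define A :: "real ^ 'n \<Rightarrow> real ^ 'n" where "A = shear i j k (\<lambda>t. 1 * t) (\<lambda>t. 1 * t)"
  have lin: "linear A" unfolding A_def by (rule linear_shear)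
  have "surj A" unfolding A_def using ijk by (rule surj_shear)
  then have "invertible (matrix A)"
    using lin by (simp add: invertible_right_inverse matrix_right_invertible_surjective)
  then have "invertible_affine A"
    unfolding invertible_affine_def
    by (intro exI[of _ "matrix A"] exI[of _ 0]) (simp add: lin)
  \<comment> \<open>A linear map has the same increments at every point.\<close>
  moreover have const: "linear_distortion_at A x = linear_distortion_at A 0" for x
    by (rule linear_distortion_at_eq_linear)
      (simp_all add: linear_0[OF lin] linear_diff[OF lin] dist_norm norm_minus_commute)
  then have "linear_distortion UNIV A = linear_distortion_at A 0"
    by (rule linear_distortion_const)
  moreover have "ereal (\<alpha> * 700) \<le> linear_distortion_at A 0"
  proof -
    \<comment> \<open>The ratio 1000/700 beats \<open>sqrt 2\<close> because 2 * 49 = 98 is below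
      100; one choice of constants thus serves every \<alpha>.\<close>
    have "sqrt 2 \<le> 10 / 7" by (rule real_le_lsqrt) (auto simp: power2_eq_square)
    then have "ereal (\<alpha> * 700) \<le> ereal 1000" using assms(2) by simp
    also have "\<dots> \<le> linear_distortion_at A 0"
      unfolding A_def using ijk by (rule linear_distortion_at_shear_ge)
    finally show ?thesis .
  qed
  moreover have "locally_uniform_limit (\<lambda>N. laminate i j k (Suc N)) A"
    unfolding locally_uniform_limit_def A_def using uniform_limit_laminate[OF ijk] by blast
  ultimately show ?thesis
    using quasiconformal_laminate[OF ijk] linear_distortion_laminate[OF ijk] const
    by (intro exI[of _ 700] exI[of _ A] exI[of _ "\<lambda>N. laminate i j k (Suc N)"]) auto
qed

end
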